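(* Let $f:\mathbb R^2\to(0,\infty)$ be $$f(\xi_1,\xi_2)=\frac{1}{2\sqrt{\pi}}(1+\xi_1^2)^{-3/2}\exp\!\Big(-\xi_1^2-\frac{\xi_2^2}{4(1+\xi_1^2)}\Big),$$ let $\mu$ be the finite measure on $\mathbb R^2$ with Lebesgue density $f$, let $G(u)=\int_{\mathbb R^2}e^{\langle u,\xi\rangle}\,\mu(d\xi)\in(0,\infty]$ for $u\in\mathbb R^2$, and let $V=\{u\in\mathbb R^2 : G(u)<\infty\}$. Let $\mathcal C$ be the set of continuous curves $c:[0,1]\to V$ with $c(1)=(0,1)$. Then $G$ has the following (interrelated) properties: (1) There exists $c\in\mathcal C$ such that for each $p\in[e\pi,\infty]$ there exists a sequence $(t_k)_{k\ge1}$ in $[0,1)$ with $t_k\uparrow 1$ and $\lim_{k\to\infty}G(c(t_k))=p$. (2) For each $p\in[e\pi,\infty]$ there exists $c\in\mathcal C$ such that $\lim_{t\uparrow1}G(c(t))=p$. (3) Let $(g^k)_{k\ge1}$ be any sequence in $[e\pi,\infty]$. Then there exist some $c\in\mathcal C$ and a sequence $(t_j)_{j\ge1}$ with $t_j\uparrow1$ such that $(g^k)_{k\ge1}$ equals the accumulation points of the sequence $(G(c(t_j)))_{j\ge1}$, that is, the set $\{g^k : k\ge1\}$ is equal to the set of accumulation points of $(G(c(t_j)))_{j\ge1}$.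
   Context: Here $\langle\cdot,\cdot\rangle$ is the standard Euclidean scalar product on $\mathbb R^2$, and $(0,1)$ denotes the point of $\mathbb R^2$ with coordinates $0$ and $1$ (not an interval). $G$ is the moment generating function of $\mu$ and $V$ its domain; one has $V=(\mathbb R\times(-1,1))\cup\{(0,1),(0,-1)\}$, where $(-1,1)$ is the open interval and $(0,\pm1)$ are points, and $G((0,1))=e\pi$, where $e$ is Euler's number. Limits and accumulation points may take the value $\infty$; an accumulation point of a sequence is the limit of one of its subsequences.
   Formalization: In (3) the set {g^k : k≥1} is replaced by its closure in [eπ,∞]: the set of accumulation points is always closed, so (3) as printed fails e.g. for g^k = eπ+1/k; when {g^k} is closed the printed equality follows. *)

theory Defs
  imports "HOL-Analysis.Analysis"
begin

definition dens :: "real \<times> real \<Rightarrow> real" where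
  "dens \<xi> = 1 / (2 * sqrt pi) * (1 + (fst \<xi>)\<^sup>2) powr (- 3 / 2) *
     exp (- (fst \<xi>)\<^sup>2 - (snd \<xi>)\<^sup>2 / (4 * (1 + (fst \<xi>)\<^sup>2)))"

definition mu :: "(real \<times> real) measure" where
  "mu = density lborel (\<lambda>\<xi>. ennreal (dens \<xi>))"

definition G :: "real \<times> real \<Rightarrow> ennreal" where
  "G u = (\<integral>\<^sup>+ \<xi>. ennreal (exp (u \<bullet> \<xi>)) \<partial>mu)"

definition V :: "(real \<times> real) set" where
  "V = {u. G u < \<infinity>}"

(* Curves are total functions on the reals; only their values on [0,1] matter. *)
definition curves :: "(real \<Rightarrow> real \<times> real) set" where
  "curves = {c. continuous_on {0..1} c \<and> c ` {0..1} \<subseteq> V \<and> c 1 = (0, 1)}"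

(* The notation t_k \<up> 1: non-decreasing, strictly below the limit 1. *)
definition increases_to_1 :: "(nat \<Rightarrow> real) \<Rightarrow> bool" where
  "increases_to_1 t \<longleftrightarrow> range t \<subseteq> {0..<1} \<and> incseq t \<and> t \<longlonglongrightarrow> 1"

(* Subsequential limits, not limit points of the range: a value that is attained
   infinitely often counts. Taken in ennreal, this includes the value \<infinity>. *)
definition accumulation_points :: "(nat \<Rightarrow> 'a::topological_space) \<Rightarrow> 'a set" where
  "accumulation_points X = {l. \<exists>r. strict_mono r \<and> (X \<circ> r) \<longlonglongrightarrow> l}"

lemma accumulation_points_iff:
  fixes X :: "nat \<Rightarrow> 'a::first_countable_topology"
  shows "l \<in> accumulation_points X \<longleftrightarrow> (\<forall>U. open U \<longrightarrow> l \<in> U \<longrightarrow> (\<exists>\<^sub>F n in sequentially. X n \<in> U))"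
proof
  assume "l \<in> accumulation_points X"
  then obtain r :: "nat \<Rightarrow> nat" where r: "strict_mono r" "(X \<circ> r) \<longlonglongrightarrow> l"
    by (auto simp: accumulation_points_def)
  show "\<forall>U. open U \<longrightarrow> l \<in> U \<longrightarrow> (\<exists>\<^sub>F n in sequentially. X n \<in> U)"
  proof (intro allI impI)
    fix U assume "open U" "l \<in> U"
    with r(2) have "\<forall>\<^sub>F n in sequentially. X (r n) \<in> U"
      by (simp add: tendsto_def)
    then obtain N where N: "\<And>n. n \<ge> N \<Longrightarrow> X (r n) \<in> U" by (auto simp: eventually_sequentially)
    show "\<exists>\<^sub>F n in sequentially. X n \<in> U"
      unfolding frequently_sequentially
    proof
      fix m
      have "r (max m N) \<ge> m" using seq_suble[OF r(1), of "max m N"] by linarith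
      then show "\<exists>n\<ge>m. X n \<in> U" using N[of "max m N"] by auto
    qed
  qed
next
  assume *: "\<forall>U. open U \<longrightarrow> l \<in> U \<longrightarrow> (\<exists>\<^sub>F n in sequentially. X n \<in> U)"
  obtain A :: "nat \<Rightarrow> 'a set" where A: "\<And>i. open (A i)" "\<And>i. l \<in> A i"
    "\<And>F. (\<forall>n. F n \<in> A n) \<Longrightarrow> F \<longlonglongrightarrow> l"
    by (rule first_countable_topology_class.countable_basis) blast
  have "\<exists>r::nat \<Rightarrow> nat. \<forall>n. X (r n) \<in> A n \<and> r n < r (Suc n)"
  proof (rule dependent_nat_choice)
    have "\<exists>y\<ge>m. X y \<in> A n" for m n
      using * A(1,2)[of n] unfolding frequently_sequentially by blast
    note B = this
    show "\<exists>x. X x \<in> A 0" using B[of 0 0] by auto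
    show "\<exists>y. X y \<in> A (Suc n) \<and> x < y" for x n
      using B[of "Suc x" "Suc n"] by (auto simp: Suc_le_eq)
  qed
  then obtain r :: "nat \<Rightarrow> nat" where r: "\<And>n. X (r n) \<in> A n" "\<And>n. r n < r (Suc n)"
    by blast
  have "strict_mono r" using r(2) by (simp add: strict_mono_Suc_iff)
  moreover have "(X \<circ> r) \<longlonglongrightarrow> l" using r(1) by (intro A(3)) simp
  ultimately show "l \<in> accumulation_points X"
    unfolding accumulation_points_def by blast
qed

(* Consequently a prescribed set {g^k : k >= 1} that is not closed, such as
   {e * pi + 1 / k : k >= 1}, is never the set of accumulation points of a sequence;
   the accumulation points can only be prescribed up to closure, and the equation
   closure (range g) = accumulation_points X specializes to
   range g = accumulation_points X exactly when range g is closed. *)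
lemma closed_accumulation_points:
  fixes X :: "nat \<Rightarrow> 'a::first_countable_topology"
  shows "closed (accumulation_points X)"
proof -
  have "open (- accumulation_points X)"
  proof (subst open_subopen, rule ballI)
    fix x assume "x \<in> - accumulation_points X"
    then obtain U where "open U" "x \<in> U" "\<not> (\<exists>\<^sub>F n in sequentially. X n \<in> U)"
      by (auto simp: accumulation_points_iff)
    then show "\<exists>T. open T \<and> x \<in> T \<and> T \<subseteq> - accumulation_points X"
      by (intro exI[of _ U]) (auto simp: accumulation_points_iff)
  qed
  then show ?thesis by (simp add: closed_def)
qed

end

theory Submission
  imports Defs "HOL-Probability.Probability" "HOL-Real_Asymp.Real_Asymp"
begin

text \<open>
  Integrating out the second coordinate, a Gaussian integral, gives for \<open>0 \<le> t < 1\<close>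
  \[ G(a, \sqrt t) = e^t \int e^{a x - (1 - t) x^2} \frac{dx}{1 + x^2}
       = e^t \int \cosh(a x)\, e^{-(1 - t) x^2} \frac{dx}{1 + x^2}. \]
  This is continuous, strictly increasing in \<open>a \<ge> 0\<close>, below \<open>e \<pi>\<close> at \<open>a = 0\<close>, and at
  \<open>a = (1 - t)\<^sup>1\<^sup>/\<^sup>4 \<rightarrow> 0\<close> it exceeds \<open>1 / (1 - t)\<close> for \<open>t\<close> near 1. So every continuous
  \<open>p : [0, 1) \<rightarrow> [e \<pi>, \<infinity>)\<close> with \<open>p t \<le> 1 / (1 - t)\<close> near 1 is \<open>G \<circ> c\<close> on \<open>[0, 1)\<close> for some
  curve \<open>c\<close>: solve \<open>G (a, \<surd>t) = p t\<close> for \<open>a\<close>. Property (3) follows by interpolating a sequence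
  that visits each \<open>g\<^sup>k\<close> infinitely often, truncated to respect the growth bound; property (1) is
  property (3) for a dense sequence.
\<close>

text \<open>Relative to this finite measure the integrands below are bounded for \<open>t < 1\<close>.\<close>

definition cauchy_measure :: "real measure" where
  "cauchy_measure = density lborel (\<lambda>x. ennreal (1 / (1 + x\<^sup>2)))"

lemma space_cauchy [simp]: "space cauchy_measure = UNIV"
  by (simp add: cauchy_measure_def)

lemma sets_cauchy [simp, measurable_cong]: "sets cauchy_measure = sets borel"
  by (simp add: cauchy_measure_def)

lemma emeasure_cauchy_UNIV: "emeasure cauchy_measure UNIV = ennreal pi"
proof -
  have i: "integrable lborel (\<lambda>x::real. inverse (1 + x\<^sup>2))"
    using integrable_inverse_1_plus_square by (simp add: set_integrable_def)
  have e: "(LINT x|lborel. inverse (1 + x\<^sup>2)) = pi"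
    using LBINT_inverse_1_plus_square
    by (simp add: interval_lebesgue_integral_def set_lebesgue_integral_def)
  have "emeasure cauchy_measure UNIV = (\<integral>\<^sup>+ x. ennreal (inverse (1 + x\<^sup>2)) \<partial>lborel)"
    by (simp add: cauchy_measure_def emeasure_density divide_inverse)
  also have "\<dots> = ennreal pi"
    using nn_integral_eq_integral[OF i] e by (simp add: add_nonneg_nonneg)
  finally show ?thesis .
qed

interpretation cauchy_measure: finite_measure cauchy_measure
  by standard (simp add: emeasure_cauchy_UNIV)

lemma measure_cauchy_UNIV: "measure cauchy_measure UNIV = pi"
  by (simp add: measure_def emeasure_cauchy_UNIV)

text \<open>The density decreases for x >= 0, so its value at \<open>v\<close> bounds it below on
  the interval.\<close>

lemma measure_cauchy_interval_ge:
  assumes "0 \<le> u" "u \<le> v"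
  shows "(v - u) / (1 + v\<^sup>2) \<le> measure cauchy_measure {u..v}"
proof -
  have "ennreal ((v - u) / (1 + v\<^sup>2)) = (\<integral>\<^sup>+ x. ennreal (1 / (1 + v\<^sup>2)) * indicator {u..v} x \<partial>lborel)"
    using assms by (simp add: nn_integral_cmult_indicator flip: ennreal_mult)
  also have "\<dots> \<le> (\<integral>\<^sup>+ x. ennreal (1 / (1 + x\<^sup>2)) * indicator {u..v} x \<partial>lborel)"
    using assms
    by (intro nn_integral_mono)
      (auto simp: indicator_def intro!: ennreal_leI divide_left_mono power_mono mult_pos_pos add_pos_nonneg)
  also have "\<dots> = emeasure cauchy_measure {u..v}"
    by (simp add: cauchy_measure_def emeasure_density)
  finally show ?thesis
    by (simp add: cauchy_measure.emeasure_eq_measure)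
qed

lemma AE_cauchy_nonzero: "AE x in cauchy_measure. x \<noteq> 0"
  unfolding cauchy_measure_def by (subst AE_density) (use AE_lborel_singleton[of 0] in auto)

lemma integral_cauchy_reflect:
  fixes f :: "real \<Rightarrow> real"
  assumes [measurable]: "f \<in> borel_measurable borel"
  shows "(LINT x|cauchy_measure. f (- x)) = (LINT x|cauchy_measure. f x)"
  unfolding cauchy_measure_def
  using lborel_integral_real_affine[of "-1" "\<lambda>x. 1 / (1 + x\<^sup>2) * f x" 0]
  by (simp add: integral_density)

section \<open>Reduction of \<open>G\<close> to a one-dimensional integral\<close>

text \<open>For fixed \<open>x\<close>, completing the square in \<open>y\<close> leaves a factor
  independent of \<open>y\<close> times a normal density. The power -3/2 splits into the Cauchy
  weight and the normalization of that density.\<close>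

lemma G_eq_nn_integral_cauchy:
  "G (a, b) = (\<integral>\<^sup>+ x. ennreal (exp (b\<^sup>2) * exp (a * x - (1 - b\<^sup>2) * x\<^sup>2)) \<partial>cauchy_measure)"
proof -
  have dens_eq: "dens (x, y) * exp (a * x + b * y) =
      1 / (1 + x\<^sup>2) * (exp (b\<^sup>2) * exp (a * x - (1 - b\<^sup>2) * x\<^sup>2)) *
      normal_density (2 * (1 + x\<^sup>2) * b) (sqrt (2 * (1 + x\<^sup>2))) y" for x y
  proof -
    define q where "q = 1 + x\<^sup>2"
    have q: "q > 0" by (simp add: q_def add_pos_nonneg)
    have qp: "q powr (- 3 / 2) = 1 / (q * sqrt q)"
    proof -
      have "q powr (- 3 / 2) = 1 / q powr (1 + 1 / 2)"
        by (simp add: powr_minus_divide)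
      also have "\<dots> = 1 / (q * sqrt q)"
        using q unfolding powr_add by (simp add: powr_half_sqrt)
      finally show ?thesis .
    qed
    \<comment> \<open>The square leaves q b^2 = b^2 + b^2 x^2: the first term yields the factor
      e^(b^2), the second weakens the damping from x^2 to (1 - b^2) x^2.\<close>
    have ex: "(- x\<^sup>2 - y\<^sup>2 / (4 * q)) + (a * x + b * y) =
        (b\<^sup>2 + (a * x - (1 - b\<^sup>2) * x\<^sup>2)) + - (y - 2 * q * b)\<^sup>2 / (2 * (2 * q))"
    proof -
      have "- (y - 2 * q * b)\<^sup>2 / (2 * (2 * q)) = - y\<^sup>2 / (4 * q) + b * y - q * b\<^sup>2"
        using q by (simp add: field_simps power2_eq_square)
      then show ?thesis by (simp add: q_def algebra_simps)
    qed
    have sq: "sqrt (2 * pi * (sqrt (2 * q))\<^sup>2) = 2 * sqrt pi * sqrt q"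
      using q by (simp add: real_sqrt_mult)
    have "dens (x, y) * exp (a * x + b * y) =
       1 / (2 * sqrt pi) * (1 / (q * sqrt q)) * exp ((- x\<^sup>2 - y\<^sup>2 / (4 * q)) + (a * x + b * y))"
      unfolding dens_def exp_add fst_conv snd_conv q_def[symmetric] qp by simp
    also have "\<dots> = 1 / q * (exp (b\<^sup>2) * exp (a * x - (1 - b\<^sup>2) * x\<^sup>2)) *
      normal_density (2 * q * b) (sqrt (2 * q)) y"
      unfolding ex exp_add normal_density_def sq using q by simp
    finally show ?thesis by (simp add: q_def)
  qed
  have "dens \<in> borel_measurable (borel \<Otimes>\<^sub>M borel)"
    unfolding dens_def by measurable
  then have [measurable]: "dens \<in> borel_measurable borel"
    by (simp add: borel_prod)
  have nd: "(\<integral>\<^sup>+ y. ennreal (normal_density m s y) \<partial>lborel) = 1" if "s > 0" for m s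
    using nn_integral_eq_integral[OF integrable_normal_density[OF that]] that
    by (simp add: integral_normal_density)
  have "G (a, b) = (\<integral>\<^sup>+ \<xi>. ennreal (dens \<xi>) * ennreal (exp ((a, b) \<bullet> \<xi>)) \<partial>lborel)"
    unfolding G_def mu_def by (subst nn_integral_density) auto
  also have "\<dots> = (\<integral>\<^sup>+ \<xi>. ennreal (dens \<xi>) * ennreal (exp ((a, b) \<bullet> \<xi>)) \<partial>(lborel \<Otimes>\<^sub>M lborel))"
    by (simp only: lborel_prod)
  also have "\<dots> = (\<integral>\<^sup>+ x. \<integral>\<^sup>+ y. ennreal (dens (x, y)) * ennreal (exp ((a, b) \<bullet> (x, y))) \<partial>lborel \<partial>lborel)"
    by (subst lborel.nn_integral_fst[symmetric]) (auto simp: lborel_prod)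
  also have "\<dots> = (\<integral>\<^sup>+ x. \<integral>\<^sup>+ y. ennreal (1 / (1 + x\<^sup>2) * (exp (b\<^sup>2) * exp (a * x - (1 - b\<^sup>2) * x\<^sup>2))) *
      ennreal (normal_density (2 * (1 + x\<^sup>2) * b) (sqrt (2 * (1 + x\<^sup>2))) y) \<partial>lborel \<partial>lborel)"
  proof (intro nn_integral_cong)
    fix x y :: real
    have nn: "dens (x, y) \<ge> 0" by (simp add: dens_def)
    have "ennreal (dens (x, y)) * ennreal (exp ((a, b) \<bullet> (x, y))) = ennreal (dens (x, y) * exp (a * x + b * y))"
      using nn by (simp add: ennreal_mult)
    also have "\<dots> = ennreal (1 / (1 + x\<^sup>2) * (exp (b\<^sup>2) * exp (a * x - (1 - b\<^sup>2) * x\<^sup>2))) *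
      ennreal (normal_density (2 * (1 + x\<^sup>2) * b) (sqrt (2 * (1 + x\<^sup>2))) y)"
      unfolding dens_eq by (intro ennreal_mult) (auto simp: add_nonneg_nonneg)
    finally show "ennreal (dens (x, y)) * ennreal (exp ((a, b) \<bullet> (x, y))) = \<dots>" .
  qed
  also have "\<dots> = (\<integral>\<^sup>+ x. ennreal (1 / (1 + x\<^sup>2) * (exp (b\<^sup>2) * exp (a * x - (1 - b\<^sup>2) * x\<^sup>2))) \<partial>lborel)"
    by (intro nn_integral_cong) (simp add: nn_integral_cmult nd add_pos_nonneg)
  also have "\<dots> = (\<integral>\<^sup>+ x. ennreal (1 / (1 + x\<^sup>2)) * ennreal (exp (b\<^sup>2) * exp (a * x - (1 - b\<^sup>2) * x\<^sup>2)) \<partial>lborel)"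
    by (intro nn_integral_cong ennreal_mult) (auto simp: add_nonneg_nonneg)
  also have "\<dots> = (\<integral>\<^sup>+ x. ennreal (exp (b\<^sup>2) * exp (a * x - (1 - b\<^sup>2) * x\<^sup>2)) \<partial>cauchy_measure)"
    unfolding cauchy_measure_def by (subst nn_integral_density) auto
  finally show ?thesis .
qed

lemma G_0_1: "G (0, 1) = ennreal (exp 1 * pi)"
  by (simp add: G_eq_nn_integral_cauchy emeasure_cauchy_UNIV ennreal_mult)

section \<open>Monotonicity and continuity of the transform for t < 1\<close>

text \<open>The parameter \<open>t\<close> is the square of the second coordinate; cosh replaces the
  exponential so that monotonicity in a >= 0 holds pointwise under the integral.\<close>

definition mgf :: "real \<Rightarrow> real \<Rightarrow> real" where
  "mgf a t = exp t * (LINT x|cauchy_measure. cosh (a * x) * exp (- (1 - t) * x\<^sup>2))"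

text \<open>The right side is the maximum over \<open>x\<close>, attained at x = a / (2 s).\<close>

lemma exp_gauss_le:
  fixes a s x :: real
  assumes "s > 0"
  shows "exp (a * x - s * x\<^sup>2) \<le> exp (a\<^sup>2 / (4 * s))"
proof -
  have "0 \<le> (2 * s * x - a)\<^sup>2 / (4 * s)" using assms by simp
  also have "\<dots> = a\<^sup>2 / (4 * s) - (a * x - s * x\<^sup>2)"
    using assms by (simp add: field_simps power2_eq_square)
  finally show ?thesis by simp
qed

lemma cosh_mult_exp:
  fixes a s x :: real
  shows "cosh (a * x) * exp (- s * x\<^sup>2) = (exp (a * x - s * x\<^sup>2) + exp (- a * x - s * x\<^sup>2)) / 2"
  by (simp add: cosh_def algebra_simps flip: exp_add)

lemma cosh_gauss_le:
  fixes a s x :: real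
  assumes "s > 0"
  shows "cosh (a * x) * exp (- s * x\<^sup>2) \<le> exp (a\<^sup>2 / (4 * s))"
  using exp_gauss_le[OF assms, of a x] exp_gauss_le[OF assms, of "- a" x]
  unfolding cosh_mult_exp by (simp del: exp_le_cancel_iff)

lemma integrable_exp_gauss:
  fixes a s :: real
  assumes "s > 0"
  shows "integrable cauchy_measure (\<lambda>x. exp (a * x - s * x\<^sup>2))"
  using exp_gauss_le[OF assms]
  by (intro cauchy_measure.integrable_const_bound[where B = "exp (a\<^sup>2 / (4 * s))"]) auto

lemma integrable_cosh_gauss:
  fixes a s :: real
  assumes "s > 0"
  shows "integrable cauchy_measure (\<lambda>x. cosh (a * x) * exp (- s * x\<^sup>2))"
  unfolding cosh_mult_exp using integrable_exp_gauss[OF assms, of a] integrable_exp_gauss[OF assms, of "- a"]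
  by simp

text \<open>Reflection in \<open>x\<close> averages e^(a x) and e^(-a x) to cosh (a x); both halves
  are integrable because t < 1.\<close>

lemma G_eq_mgf:
  assumes "0 \<le> t" "t < 1"
  shows "G (a, sqrt t) = ennreal (mgf a t)"
proof -
  define s where "s = 1 - t"
  have s: "s > 0" using assms by (simp add: s_def)
  have "G (a, sqrt t) = ennreal (LINT x|cauchy_measure. exp t * exp (a * x - s * x\<^sup>2))"
    unfolding G_eq_nn_integral_cauchy using assms integrable_exp_gauss[OF s, of a]
    by (subst nn_integral_eq_integral[symmetric]) (auto simp: s_def)
  also have "(LINT x|cauchy_measure. exp t * exp (a * x - s * x\<^sup>2)) = exp t * (LINT x|cauchy_measure. exp (a * x - s * x\<^sup>2))"
    by simp
  also have "(LINT x|cauchy_measure. exp (a * x - s * x\<^sup>2)) = (LINT x|cauchy_measure. cosh (a * x) * exp (- s * x\<^sup>2))"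
    unfolding cosh_mult_exp
    using integral_cauchy_reflect[of "\<lambda>x. exp (a * x - s * x\<^sup>2)"]
      integrable_exp_gauss[OF s, of a] integrable_exp_gauss[OF s, of "- a"]
    by simp
  finally show ?thesis by (simp add: mgf_def s_def)
qed

text \<open>The integrands are strictly ordered except at the null set {0}.\<close>

lemma mgf_strict_mono:
  assumes "0 \<le> a" "a < b" "t < 1"
  shows "mgf a t < mgf b t"
proof -
  have "(LINT x|cauchy_measure. cosh (a * x) * exp (- (1 - t) * x\<^sup>2)) < (LINT x|cauchy_measure. cosh (b * x) * exp (- (1 - t) * x\<^sup>2))"
  proof (intro cauchy_measure.integral_less_AE_space integrable_cosh_gauss)
    have "cosh (a * x) < cosh (b * x)" if "x \<noteq> 0" for x
    proof -
      have "cosh (a * \<bar>x\<bar>) < cosh (b * \<bar>x\<bar>)"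
        using assms that by (subst cosh_real_nonneg_less_iff) auto
      then show ?thesis by (cases "x \<ge> 0") auto
    qed
    then show "AE x in cauchy_measure. cosh (a * x) * exp (- (1 - t) * x\<^sup>2) < cosh (b * x) * exp (- (1 - t) * x\<^sup>2)"
      using AE_cauchy_nonzero by auto
  qed (use assms in \<open>auto simp: emeasure_cauchy_UNIV\<close>)
  then show ?thesis by (simp add: mgf_def)
qed

lemma mgf_0_less:
  assumes "t < 1"
  shows "mgf 0 t < exp 1 * pi"
proof -
  have "(LINT x|cauchy_measure. exp (- (1 - t) * x\<^sup>2)) \<le> (LINT x|cauchy_measure. 1)"
    using assms integrable_cosh_gauss[of "1 - t" 0] by (intro integral_mono) (auto intro: mult_nonpos_nonneg)
  then have "mgf 0 t \<le> exp t * pi"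
    by (simp add: mgf_def measure_cauchy_UNIV)
  also have "\<dots> < exp 1 * pi" using assms by simp
  finally show ?thesis .
qed

text \<open>Dominated convergence: the exponents in \<open>cosh_gauss_le\<close> converge along the
  sequence, hence are bounded, so one constant dominates all integrands.\<close>

lemma tendsto_mgf:
  assumes a: "a \<longlonglongrightarrow> a0" and t: "t \<longlonglongrightarrow> t0" and "t0 < 1" and t_less: "\<And>n. t n < 1"
  shows "(\<lambda>n::nat. mgf (a n) (t n)) \<longlonglongrightarrow> mgf a0 t0"
proof -
  have "(\<lambda>n. (a n)\<^sup>2 / (4 * (1 - t n))) \<longlonglongrightarrow> a0\<^sup>2 / (4 * (1 - t0))"
    using \<open>t0 < 1\<close> by (intro tendsto_intros a t) auto
  then have "Bseq (\<lambda>n. (a n)\<^sup>2 / (4 * (1 - t n)))"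
    by (intro convergent_imp_Bseq) (auto simp: convergent_def)
  then obtain K where K: "\<And>n. norm ((a n)\<^sup>2 / (4 * (1 - t n))) \<le> K"
    unfolding Bseq_def by blast
  have bound: "cosh (a n * x) * exp (- (1 - t n) * x\<^sup>2) \<le> exp K" for n x
  proof -
    have "cosh (a n * x) * exp (- (1 - t n) * x\<^sup>2) \<le> exp ((a n)\<^sup>2 / (4 * (1 - t n)))"
      using t_less[of n] by (intro cosh_gauss_le) simp
    also have "\<dots> \<le> exp K" using abs_le_D1[OF K[of n, unfolded real_norm_def]] by (simp only: exp_le_cancel_iff)
    finally show ?thesis .
  qed
  have "(\<lambda>n. LINT x|cauchy_measure. cosh (a n * x) * exp (- (1 - t n) * x\<^sup>2)) \<longlonglongrightarrow>
      (LINT x|cauchy_measure. cosh (a0 * x) * exp (- (1 - t0) * x\<^sup>2))"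
  proof (rule integral_dominated_convergence[where w = "\<lambda>_. exp K"])
    show "AE x in cauchy_measure. norm (cosh (a n * x) * exp (- (1 - t n) * x\<^sup>2)) \<le> exp K" for n
      using bound[of n] by (auto simp: abs_mult)
    show "AE x in cauchy_measure. (\<lambda>n. cosh (a n * x) * exp (- (1 - t n) * x\<^sup>2)) \<longlonglongrightarrow>
        cosh (a0 * x) * exp (- (1 - t0) * x\<^sup>2)"
      by (intro AE_I2 tendsto_intros a t)
  qed (auto simp: cosh_def)
  then show ?thesis
    unfolding mgf_def by (intro tendsto_intros t)
qed

section \<open>Growth of the transform\<close>

text \<open>Only the interval and the half e^(a x) / 2 of cosh are kept, with the exponent bounded
  through the endpoints; the factor e^t >= 1 is dropped.\<close>

lemma mgf_ge_interval:
  assumes "0 \<le> a" "t < 1" "0 \<le> t" "0 \<le> u" "u \<le> v"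
  shows "(v - u) / (1 + v\<^sup>2) * (exp (a * u - (1 - t) * v\<^sup>2) / 2) \<le> mgf a t"
proof -
  let ?C = "exp (a * u - (1 - t) * v\<^sup>2) / 2"
  have int: "integrable cauchy_measure (\<lambda>x. ?C * indicator {u..v} x)"
    by (intro integrable_mult_right integrable_real_indicator)
      (auto simp: cauchy_measure.emeasure_eq_measure)
  have "(v - u) / (1 + v\<^sup>2) * ?C \<le> measure cauchy_measure {u..v} * ?C"
    using measure_cauchy_interval_ge[OF assms(4,5)] by (intro mult_right_mono) auto
  also have "\<dots> = (LINT x|cauchy_measure. ?C * indicator {u..v} x)"
    by simp
  also have "\<dots> \<le> (LINT x|cauchy_measure. cosh (a * x) * exp (- (1 - t) * x\<^sup>2))"
  proof (intro integral_mono integrable_cosh_gauss int)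
    show "?C * indicator {u..v} x \<le> cosh (a * x) * exp (- (1 - t) * x\<^sup>2)" for x
    proof (cases "x \<in> {u..v}")
      case True
      have "a * u \<le> a * x" "(1 - t) * x\<^sup>2 \<le> (1 - t) * v\<^sup>2"
        using True assms by (auto intro!: mult_left_mono power_mono)
      then have "exp (a * u - (1 - t) * v\<^sup>2) \<le> exp (a * x - (1 - t) * x\<^sup>2)" by simp
      also have "\<dots> \<le> exp (a * x - (1 - t) * x\<^sup>2) + exp (- a * x - (1 - t) * x\<^sup>2)" by simp
      finally show ?thesis unfolding cosh_mult_exp using True by simp
    qed simp
  qed (use assms in auto)
  also have "\<dots> \<le> mgf a t"
  proof -
    have "0 \<le> (LINT x|cauchy_measure. cosh (a * x) * exp (- (1 - t) * x\<^sup>2))"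
      by (intro integral_nonneg_AE) auto
    then show ?thesis using assms mult_right_mono[of 1 "exp t"] by (simp add: mgf_def)
  qed
  finally show ?thesis .
qed

text \<open>Obtained from the interval from \<open>(1 - t)\<^sup>-\<^sup>1\<^sup>/\<^sup>2\<close> to \<open>2 (1 - t)\<^sup>-\<^sup>1\<^sup>/\<^sup>2\<close>.\<close>

lemma mgf_root_ge:
  "\<forall>\<^sub>F t in at_left 1. 1 / (1 - t) \<le> mgf ((1 - t) powr (1/4)) t"
proof -
  let ?L = "\<lambda>t::real. (2 / sqrt (1 - t) - 1 / sqrt (1 - t)) / (1 + (2 / sqrt (1 - t))\<^sup>2) *
      (exp ((1 - t) powr (1/4) * (1 / sqrt (1 - t)) - (1 - t) * (2 / sqrt (1 - t))\<^sup>2) / 2)"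
  \<comment> \<open>With s = 1 - t, \<open>?L t\<close> equals sqrt s / (s + 4) * exp (s^(-1/4) - 4)
    / 2, and the exponential beats every power of 1 / s.\<close>
  have "\<forall>\<^sub>F t in at_left 1. 1 / (1 - t) \<le> ?L t"
    by real_asymp
  moreover have "\<forall>\<^sub>F t in at_left (1::real). 0 < t \<and> t < 1"
    by (simp add: eventually_at_left_field eventually_conj_iff)
       (metis zero_less_one)
  ultimately show ?thesis
  proof eventually_elim
    case (elim t)
    have "?L t \<le> mgf ((1 - t) powr (1/4)) t"
      using elim by (intro mgf_ge_interval) (auto simp: divide_right_mono)
    then show ?case using elim by linarith
  qed
qed

lemma mgf_unbounded:
  assumes "0 \<le> t" "t < 1"
  shows "\<exists>a\<ge>0. M \<le> mgf a t"
proof -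
  \<comment> \<open>This is the interval bound from 1 to 2; a positive left end gives exponential
    growth in \<open>a\<close>.\<close>
  let ?L = "\<lambda>a::real. (2 - 1) / (1 + 2\<^sup>2) * (exp (a * 1 - (1 - t) * 2\<^sup>2) / 2)"
  have "filterlim ?L at_top at_top"
    by real_asymp
  then have "\<forall>\<^sub>F a in at_top. M \<le> ?L a \<and> 0 \<le> a"
    using eventually_ge_at_top[of 0] by (auto simp: filterlim_at_top eventually_conj_iff)
  then obtain a where "M \<le> ?L a" "0 \<le> a"
    unfolding eventually_at_top_linorder by blast
  with mgf_ge_interval[of a t 1 2] assms show ?thesis by force
qed

lemma continuous_on_mgf_left:
  assumes "t < 1"
  shows "continuous_on S (\<lambda>a. mgf a t)"
  using assms by (intro continuous_on_sequentiallyI tendsto_mgf tendsto_const) auto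

lemma continuous_on_mgf_right:
  assumes "S \<subseteq> {..<1}"
  shows "continuous_on S (mgf a)"
  using assms by (intro continuous_on_sequentiallyI tendsto_mgf tendsto_const) auto

section \<open>Curves with prescribed values of \<open>G\<close>\<close>

text \<open>Intermediate value theorem between 0, where the value lies strictly below e pi, and some
  large argument.\<close>

lemma ex_mgf_eq:
  assumes "0 \<le> t" "t < 1" "exp 1 * pi \<le> p"
  shows "\<exists>a>0. mgf a t = p"
proof -
  obtain b where b: "b \<ge> 0" "p \<le> mgf b t"
    using mgf_unbounded assms by blast
  have less: "mgf 0 t < p" using mgf_0_less[of t] assms by linarith
  then obtain a where a: "0 \<le> a" "mgf a t = p"
    using IVT'[of "\<lambda>a. mgf a t" 0 p b] b continuous_on_mgf_left[OF assms(2)] by auto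
  with less have "a \<noteq> 0" by auto
  with a show ?thesis by (intro exI[of _ a]) auto
qed

text \<open>The curve is \<open>(a t, sqrt t)\<close> with \<open>mgf (a t) t = p t\<close>. Strict
  monotonicity makes \<open>a\<close> continuous, and the growth bound on \<open>p\<close> forces
  \<open>a t\<close> to 0 as \<open>t\<close> tends to 1.\<close>

lemma ex_curve_with_values:
  assumes cont: "continuous_on {0..<1} p"
    and ge: "\<And>t. t \<in> {0..<1} \<Longrightarrow> exp 1 * pi \<le> p t"
    and le: "\<forall>\<^sub>F t in at_left 1. p t \<le> 1 / (1 - t)"
  obtains c where "c \<in> curves" "\<And>t. t \<in> {0..<1} \<Longrightarrow> G (c t) = ennreal (p t)"
proof -
  have "\<exists>a. \<forall>t\<in>{0..<1}. a t > 0 \<and> mgf (a t) t = p t"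
    using ex_mgf_eq ge by (intro bchoice) auto
  then obtain a where a: "\<And>t. t \<in> {0..<1} \<Longrightarrow> a t > 0" "\<And>t. t \<in> {0..<1} \<Longrightarrow> mgf (a t) t = p t"
    by blast
  \<comment> \<open>Comparing \<open>y\<close> with \<open>a t\<close> is reduced to the sign of
    \<open>mgf y t - p t\<close>. The second direction needs \<open>0 \<le> y\<close>, since
    \<open>mgf_strict_mono\<close> covers only nonnegative arguments.\<close>
  have less_a: "y < a t" if "t \<in> {0..<1}" "mgf y t < p t" for y t
    using that a[OF that(1)] mgf_strict_mono[of "a t" y t] by (cases y "a t" rule: linorder_cases) auto
  have a_less: "a t < y" if "t \<in> {0..<1}" "p t < mgf y t" "0 \<le> y" for y t
    using that a[OF that(1)] mgf_strict_mono[of y "a t" t] by (cases y "a t" rule: linorder_cases) auto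
  have tend_a: "(a \<longlongrightarrow> a t0) (at t0 within {0..<1})" if t0: "t0 \<in> {0..<1}" for t0
  proof -
    \<comment> \<open>For fixed \<open>y\<close> the difference is continuous in \<open>t\<close>,
      so its sign at \<open>t0\<close> persists nearby.\<close>
    have diff: "((\<lambda>t. mgf y t - p t) \<longlongrightarrow> mgf y t0 - p t0) (at t0 within {0..<1})" for y
    proof (intro tendsto_diff)
      have "continuous_on {0..<1} (mgf y)"
        by (intro continuous_on_mgf_right) auto
      then show "(mgf y \<longlongrightarrow> mgf y t0) (at t0 within {0..<1})"
        using t0 by (simp add: continuous_on_def)
      show "(p \<longlongrightarrow> p t0) (at t0 within {0..<1})"
        using cont t0 by (simp add: continuous_on_def)
    qed
    have inI: "\<forall>\<^sub>F t in at t0 within {0..<1}. t \<in> {0..<1}"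
      by (auto simp: eventually_at_filter)
    show ?thesis
    proof (rule order_tendstoI)
      fix y assume y: "y < a t0"
      show "\<forall>\<^sub>F t in at t0 within {0..<1}. y < a t"
      proof (cases "y < 0")
        case True
        show ?thesis using inI by eventually_elim (use True a(1) in force)
      next
        case False
        then have "mgf y t0 - p t0 < 0"
          using mgf_strict_mono[of y "a t0" t0] a[OF t0] y t0 by auto
        from order_tendstoD(2)[OF diff this] inI show ?thesis
          by eventually_elim (auto intro: less_a)
      qed
    next
      fix y assume y: "a t0 < y"
      then have "0 < mgf y t0 - p t0"
        using mgf_strict_mono[of "a t0" y t0] a[OF t0] y t0 by auto
      from order_tendstoD(1)[OF diff this] inI show "\<forall>\<^sub>F t in at t0 within {0..<1}. a t < y"
        by eventually_elim (use y a(1)[OF t0] in \<open>auto intro: a_less\<close>)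
    qed
  qed
  have unit: "\<forall>\<^sub>F t in at_left (1::real). t \<in> {0..<1}"
    unfolding eventually_at_left_field by (intro exI[of _ 0]) auto
  have tend_1: "(a \<longlongrightarrow> 0) (at_left 1)"
  proof (rule tendsto_sandwich)
    show "\<forall>\<^sub>F t in at_left 1. 0 \<le> a t"
      using unit by eventually_elim (use a(1) in force)
    \<comment> \<open>Here \<open>p t\<close> is at most 1 / (1 - t), hence at most the transform at
      the fourth root of 1 - t, so \<open>a t\<close> cannot exceed that root.\<close>
    show "\<forall>\<^sub>F t in at_left 1. a t \<le> (1 - t) powr (1/4)"
      using unit le mgf_root_ge
    proof eventually_elim
      case (elim t)
      then have "mgf (a t) t \<le> mgf ((1 - t) powr (1/4)) t" using a(2) by force
      then show ?case
        using mgf_strict_mono[of "(1 - t) powr (1/4)" "a t" t] elim by force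
    qed
    show "((\<lambda>t::real. (1 - t) powr (1/4)) \<longlongrightarrow> 0) (at_left 1)"
      by real_asymp
  qed simp
  define b where "b t = (if t < 1 then a t else 0)" for t
  have "continuous_on {0..1} b"
    unfolding continuous_on_def
  proof
    fix t :: real assume t: "t \<in> {0..1}"
    show "(b \<longlongrightarrow> b t) (at t within {0..1})"
    proof (cases "t < 1")
      case True
      have "at t within {0..1} = at t within {0..<1}"
        using True by (intro at_within_nhd[of _ "{..<1}"]) auto
      moreover have "(b \<longlongrightarrow> b t) (at t within {0..<1})"
        using tend_a[of t] True t
        by (subst tendsto_cong[where g = a]) (auto simp: b_def eventually_at_filter)
      ultimately show ?thesis by simp
    next
      case False
      have "(b \<longlongrightarrow> 0) (at_left 1)"
        using tend_1 by (subst tendsto_cong[where g = a]) (auto simp: b_def eventually_at_filter)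
      moreover have "t = 1" "b t = 0" using False t by (auto simp: b_def)
      ultimately show ?thesis by (simp add: at_within_Icc_at_left)
    qed
  qed
  then have cont_c: "continuous_on {0..1} (\<lambda>t. (b t, sqrt t))"
    by (intro continuous_intros)
  have G_c: "G (b t, sqrt t) = ennreal (p t)" if "t \<in> {0..<1}" for t
    using that a(2)[OF that] by (simp add: b_def G_eq_mgf)
  have "(b t, sqrt t) \<in> V" if "t \<in> {0..1}" for t
    using that G_c[of t] G_0_1 by (cases "t = 1") (auto simp: V_def b_def)
  with cont_c have "(\<lambda>t. (b t, sqrt t)) \<in> curves"
    by (auto simp: curves_def b_def)
  with G_c show ?thesis using that by blast
qed

section \<open>Prescribed values along a sequence\<close>

text \<open>Chosen so that the growth bound 1 / (1 - t) equals j + 1 at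
  \<open>approach j\<close>.\<close>

definition approach :: "nat \<Rightarrow> real" where
  "approach j = 1 - 1 / real (Suc j)"

lemma increases_to_1_approach: "increases_to_1 approach"
proof -
  have "incseq approach"
    by (intro incseq_SucI) (simp add: approach_def field_simps)
  moreover have "approach \<longlonglongrightarrow> 1 - 0"
    unfolding approach_def by (intro tendsto_diff tendsto_const LIMSEQ_Suc[OF lim_1_over_n])
  moreover have "range approach \<subseteq> {0..<1}"
    by (auto simp: approach_def field_simps)
  ultimately show ?thesis by (simp add: increases_to_1_def)
qed

text \<open>The substitution y = 1 / (1 - t) - 1 sends \<open>approach j\<close> to
  \<open>j\<close>, so it suffices to interpolate at the natural numbers.\<close>

lemma ex_curve_through_values:
  fixes v :: "nat \<Rightarrow> real"
  assumes v: "\<And>j. 0 \<le> v j" "\<And>j. v j \<le> real (Suc j)"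
  obtains c where "c \<in> curves" "\<And>j. G (c (approach j)) = ennreal (max (exp 1 * pi) (v j))"
proof -
  \<comment> \<open>The values divided by the growth bound lie in the unit interval, where Tietze applies.\<close>
  define f where "f y = v (nat \<lfloor>y\<rfloor>) / (y + 1)" for y :: real
  have "continuous_on \<nat> f"
    by (intro Isolated.continuous_on_discrete uniform_discrete_imp_discrete)
      (auto simp: uniform_discrete_def dist_of_nat elim!: Nats_cases intro!: exI[of _ 1])
  moreover have "f y \<in> cbox 0 1" if "y \<in> \<nat>" for y
    using that v by (auto simp: f_def add.commute elim!: Nats_cases)
  ultimately obtain \<phi> where \<phi>: "continuous_on UNIV \<phi>" "\<And>y. y \<in> \<nat> \<Longrightarrow> \<phi> y = f y" "\<And>y. \<phi> y \<in> {0..1}"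
    using Tietze_closed_interval_1[of \<nat> f UNIV 0 1] by (auto simp: closedin_closed_eq)
  \<comment> \<open>Since y + 1 = 1 / (1 - t), the factor undoes the division in \<open>f\<close>;
    the maximum secures the lower bound between the nodes.\<close>
  define p where "p t = max (exp 1 * pi) (1 / (1 - t) * \<phi> (1 / (1 - t) - 1))" for t
  obtain c where c: "c \<in> curves" "\<And>t. t \<in> {0..<1} \<Longrightarrow> G (c t) = ennreal (p t)"
  proof (rule ex_curve_with_values[of p])
    show "continuous_on {0..<1} p"
      unfolding p_def by (intro continuous_intros continuous_on_compose2[OF \<phi>(1)]) auto
    have "\<forall>\<^sub>F t in at_left (1::real). exp 1 * pi \<le> 1 / (1 - t)"
      by real_asymp
    moreover have "\<forall>\<^sub>F t in at_left (1::real). t < 1"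
      by (simp add: eventually_at_filter)
    ultimately show "\<forall>\<^sub>F t in at_left 1. p t \<le> 1 / (1 - t)"
    proof eventually_elim
      case (elim t)
      then have "1 / (1 - t) * \<phi> (1 / (1 - t) - 1) \<le> 1 / (1 - t) * 1"
        using \<phi>(3) by (intro mult_left_mono) auto
      with elim show ?case by (simp add: p_def)
    qed
  qed (auto simp: p_def)
  have "p (approach j) = max (exp 1 * pi) (v j)" for j
    using \<phi>(2)[of "real j"] by (simp add: p_def approach_def f_def add.commute)
  moreover have "approach j \<in> {0..<1}" for j
    using increases_to_1_approach unfolding increases_to_1_def by blast
  ultimately show ?thesis using c that by metis
qed

section \<open>Prescribed accumulation points\<close>

text \<open>The decoding visits every index infinitely often, so each \<open>g i\<close> is a
  subsequential limit. The cutoff \<open>Suc j\<close> keeps the minimum finite, yet tends to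
  infinity and so alters no limit.\<close>

lemma accumulation_points_truncated:
  fixes g :: "nat \<Rightarrow> ennreal"
  assumes g: "\<And>i. b \<le> g i"
  shows "accumulation_points (\<lambda>j. max b (min (of_nat (Suc j)) (g (fst (prod_decode j))))) = closure (range g)"
    (is "accumulation_points ?X = _")
proof
  let ?e = "\<lambda>j. g (fst (prod_decode j))"
  have top: "(\<lambda>k. of_nat (Suc (r k)) :: ennreal) \<longlonglongrightarrow> top" if "strict_mono r" for r
    using LIMSEQ_subseq_LIMSEQ[OF LIMSEQ_Suc[OF of_nat_tendsto_top_ennreal] that]
    by (simp only: comp_def)
  show "accumulation_points ?X \<subseteq> closure (range g)"
  proof
    fix l assume "l \<in> accumulation_points ?X"
    then obtain r where r: "strict_mono r" "(\<lambda>k. ?X (r k)) \<longlonglongrightarrow> l"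
      by (auto simp: accumulation_points_def comp_def)
    have "(\<lambda>k. ?e (r k)) \<longlonglongrightarrow> l"
    proof (cases "l = top")
      case True
      show ?thesis unfolding True
      proof (rule tendsto_sandwich[OF _ _ r(2)[unfolded True] tendsto_const])
        show "\<forall>\<^sub>F k in sequentially. ?X (r k) \<le> ?e (r k)"
          using g by auto
      qed auto
    next
      case False
      then obtain m where m: "l < m" "m < top"
        using dense less_top by blast
      \<comment> \<open>Eventually the terms lie below \<open>m\<close> and the cutoffs above it, so
        the cutoff is inactive.\<close>
      have "\<forall>\<^sub>F k in sequentially. ?X (r k) = ?e (r k)"
        using order_tendstoD(2)[OF r(2) m(1)] order_tendstoD(1)[OF top[OF r(1)] m(2)]
      proof eventually_elim
        case (elim k)
        then have "min (of_nat (Suc (r k))) (?e (r k)) < of_nat (Suc (r k))"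
          by (metis max_less_iff_conj less_trans)
        then show ?case using g by (auto simp: min_def max_def not_le intro: antisym split: if_splits)
      qed
      then show ?thesis using r(2) tendsto_cong by fast
    qed
    then show "l \<in> closure (range g)"
      unfolding closure_sequential by (intro exI[of _ "\<lambda>k. ?e (r k)"]) simp
  qed
  have "range g \<subseteq> accumulation_points ?X"
  proof clarify
    fix i
    \<comment> \<open>These are the positions of index \<open>i\<close>, in increasing
      order.\<close>
    define r where "r k = prod_encode (i, k)" for k
    have r: "strict_mono r"
      unfolding strict_mono_Suc_iff r_def by (simp add: prod_encode_def)
    have "(\<lambda>k. max b (min (of_nat (Suc (r k))) (g i))) \<longlonglongrightarrow> max b (min top (g i))"
      by (intro tendsto_max tendsto_min tendsto_const top r)
    then have "(?X \<circ> r) \<longlonglongrightarrow> g i"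
      using g[of i] by (simp add: r_def comp_def max_absorb2)
    with r show "g i \<in> accumulation_points ?X"
      unfolding accumulation_points_def by blast
  qed
  then show "closure (range g) \<subseteq> accumulation_points ?X"
    by (intro closure_minimal closed_accumulation_points)
qed

text \<open>A curve is led through the truncated enumeration of \<open>g\<close>; the closure
  appears because sets of accumulation points are closed.\<close>

lemma ex_curve_accumulation_points:
  fixes g :: "nat \<Rightarrow> ennreal"
  assumes "range g \<subseteq> {ennreal (exp 1 * pi)..\<infinity>}"
  shows "\<exists>c\<in>curves. \<exists>t. increases_to_1 t \<and>
    closure (range g) = accumulation_points (\<lambda>j. G (c (t j)))"
proof -
  let ?m = "\<lambda>j. min (of_nat (Suc j)) (g (fst (prod_decode j)))"
  define v where "v j = enn2real (?m j)" for j
  \<comment> \<open>The cutoff is finite even where \<open>g\<close> is infinite, so passing to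
    reals loses nothing.\<close>
  have fin: "?m j < top" for j
    by (auto simp del: of_nat_Suc simp: min_less_iff_disj of_nat_less_top)
  have m: "ennreal (v j) = ?m j" for j
    unfolding v_def using fin by (intro ennreal_enn2real)
  have "v j \<le> real (Suc j)" for j
    unfolding v_def by (intro enn2real_leI) (auto simp del: of_nat_Suc simp: ennreal_of_nat_eq_real_of_nat)
  then obtain c where c: "c \<in> curves" "\<And>j. G (c (approach j)) = ennreal (max (exp 1 * pi) (v j))"
    using ex_curve_through_values[of v] by (auto simp: v_def)
  have "G (c (approach j)) = max (ennreal (exp 1 * pi)) (?m j)" for j
    unfolding c(2) m[symmetric] by (auto simp: max_def v_def ennreal_le_iff intro: antisym)
  then have "accumulation_points (\<lambda>j. G (c (approach j))) = closure (range g)"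
    using assms accumulation_points_truncated[of "ennreal (exp 1 * pi)" g] by (auto simp: image_subset_iff)
  with c(1) increases_to_1_approach show ?thesis by blast
qed

text \<open>The continuous retraction \<open>max b\<close> carries a dense sequence of the whole
  space to one dense in \<open>{b..}\<close>.\<close>

lemma ex_dense_sequence_atLeast:
  fixes b :: "'a :: {linorder_topology, second_countable_topology}"
  obtains g :: "nat \<Rightarrow> 'a" where "closure (range g) = {b..}"
proof -
  obtain D :: "'a set" where D: "countable D" "\<And>U. open U \<Longrightarrow> U \<noteq> {} \<Longrightarrow> \<exists>d\<in>D. d \<in> U"
    using countable_dense_setE by blast
  have cl: "closure D = UNIV"
    using D(2)[of "- closure D"] closure_subset[of D] by auto
  then have "D \<noteq> {}" by auto
  then obtain d :: "nat \<Rightarrow> 'a" where d: "range d = D"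
    using D(1) by (metis uncountable_def)
  have "{b..} = max b ` closure D"
    unfolding cl by (auto simp: image_iff intro: exI[of _ x for x] max_absorb2[symmetric])
  also have "\<dots> \<subseteq> closure (max b ` D)"
    by (intro image_closure_subset closure_subset) (auto intro!: continuous_intros)
  finally have "{b..} \<subseteq> closure (range (\<lambda>n. max b (d n)))"
    by (simp add: d[symmetric] image_image)
  moreover have "closure (range (\<lambda>n. max b (d n))) \<subseteq> {b..}"
    by (intro closure_minimal) auto
  ultimately show ?thesis using that by blast
qed

theorem lemma2p2:
  shows "(\<exists>c\<in>curves. \<forall>p\<in>{ennreal (exp 1 * pi)..\<infinity>}.
            \<exists>t. increases_to_1 t \<and> (\<lambda>k. G (c (t k))) \<longlonglongrightarrow> p) \<and>
         (\<forall>p\<in>{ennreal (exp 1 * pi)..\<infinity>}.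
            \<exists>c\<in>curves. ((\<lambda>s. G (c s)) \<longlongrightarrow> p) (at_left 1)) \<and>
         (\<forall>g :: nat \<Rightarrow> ennreal. range g \<subseteq> {ennreal (exp 1 * pi)..\<infinity>} \<longrightarrow>
            (\<exists>c\<in>curves. \<exists>t. increases_to_1 t \<and>
               closure (range g) = accumulation_points (\<lambda>j. G (c (t j)))))"
proof (intro conjI ballI allI impI ex_curve_accumulation_points)
  \<comment> \<open>Property (1): the values at common times accumulate at every admissible
    \<open>p\<close>, and a subsequence of these times serves each \<open>p\<close>.\<close>
  obtain g :: "nat \<Rightarrow> ennreal" where g: "closure (range g) = {ennreal (exp 1 * pi)..}"
    using ex_dense_sequence_atLeast .
  then have "range g \<subseteq> {ennreal (exp 1 * pi)..\<infinity>}"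
    using closure_subset[of "range g"] by auto
  then obtain c t where c: "c \<in> curves" and t: "increases_to_1 t"
    and acc: "{ennreal (exp 1 * pi)..} = accumulation_points (\<lambda>j. G (c (t j)))"
    using ex_curve_accumulation_points g by metis
  have "\<exists>t. increases_to_1 t \<and> (\<lambda>k. G (c (t k))) \<longlonglongrightarrow> p" if "p \<in> {ennreal (exp 1 * pi)..\<infinity>}" for p
  proof -
    have "p \<in> accumulation_points (\<lambda>j. G (c (t j)))"
      using that by (simp flip: acc)
    then obtain r where r: "strict_mono r" "(\<lambda>k. G (c (t (r k)))) \<longlonglongrightarrow> p"
      by (auto simp: accumulation_points_def comp_def)
    have "increases_to_1 (t \<circ> r)"
      using t r(1) LIMSEQ_subseq_LIMSEQ[of t 1 r]
      by (auto simp: increases_to_1_def incseq_def strict_mono_less_eq)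
    with r(2) show ?thesis by (auto simp: comp_def)
  qed
  with c show "\<exists>c\<in>curves. \<forall>p\<in>{ennreal (exp 1 * pi)..\<infinity>}.
      \<exists>t. increases_to_1 t \<and> (\<lambda>k. G (c (t k))) \<longlonglongrightarrow> p"
    by blast
next
  fix p assume p: "p \<in> {ennreal (exp 1 * pi)..\<infinity>}"
  \<comment> \<open>Property (2): \<open>q\<close> is constant for finite \<open>p\<close>; for
    infinite \<open>p\<close> it is 1 / (1 - t), raised to e pi where that is larger.\<close>
  obtain q where q: "continuous_on {0..<1} q" "\<And>t. t \<in> {0..<1} \<Longrightarrow> exp 1 * pi \<le> q t"
    "\<forall>\<^sub>F t in at_left 1. q t \<le> 1 / (1 - t)" "((\<lambda>t. ennreal (q t)) \<longlongrightarrow> p) (at_left 1)"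
  proof (cases p)
    case (real x)
    then have "exp 1 * pi \<le> x" using p by simp
    moreover have "\<forall>\<^sub>F t in at_left 1. x \<le> 1 / (1 - t)"
      by real_asymp
    ultimately show ?thesis
      using that[of "\<lambda>_. x"] real by auto
  next
    case top
    define q where "q t = max (exp 1 * pi) (1 / (1 - t))" for t :: real
    have "\<forall>\<^sub>F t in at_left (1::real). exp 1 * pi \<le> 1 / (1 - t)"
      by real_asymp
    then have "\<forall>\<^sub>F t in at_left 1. q t \<le> 1 / (1 - t)"
      by eventually_elim (simp add: q_def)
    moreover have "continuous_on {0..<1} q"
      unfolding q_def by (intro continuous_intros) auto
    moreover have "filterlim (\<lambda>t::real. 1 / (1 - t)) at_top (at_left 1)"
      by real_asymp
    then have "filterlim q at_top (at_left 1)"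
      by (rule filterlim_at_top_mono) (simp add: q_def)
    then have "((\<lambda>t. ennreal (q t)) \<longlongrightarrow> p) (at_left 1)"
      unfolding top by (intro ennreal_tendsto_top_eq_at_top[THEN iffD2])
    ultimately show ?thesis using that[of q] by (auto simp: q_def)
  qed
  obtain c where c: "c \<in> curves" "\<And>t. t \<in> {0..<1} \<Longrightarrow> G (c t) = ennreal (q t)"
    using ex_curve_with_values[OF q(1-3)] by blast
  have "\<forall>\<^sub>F t in at_left (1::real). t \<in> {0..<1}"
    unfolding eventually_at_left_field by (intro exI[of _ 0]) auto
  then have "\<forall>\<^sub>F t in at_left 1. G (c t) = ennreal (q t)"
    by eventually_elim (rule c(2))
  then have "((\<lambda>s. G (c s)) \<longlongrightarrow> p) (at_left 1)"
    using q(4) by (simp add: tendsto_cong)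
  with c(1) show "\<exists>c\<in>curves. ((\<lambda>s. G (c s)) \<longlongrightarrow> p) (at_left 1)" by blast
qed

end
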